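(* Let $(X,\mu)$ be a state BCK-algebra, and let $\operatorname{Ker}(\mu)=\mu^{-1}(\{0\})$. Suppose that one of the following conditions holds: (i) $\operatorname{Ker}(\mu)=\{0\}$ and $\mu(X)$ is a subdirectly irreducible subalgebra of $X$; (ii) $\operatorname{Ker}(\mu)\neq\{0\}$, $\operatorname{Ker}(\mu)$ is a subdirectly irreducible subalgebra of $X$, and $\operatorname{Ker}(\mu)\cap\langle a\rangle_X\neq\{0\}$ for each non-zero element $a$ of $\mu(X)$. Then $(X,\mu)$ is subdirectly irreducible.
   Context: A BCK-algebra is an algebra $(X,*,0)$ of type $(2,0)$ such that for all $x,y,z\in X$: $((x*y)*(x*z))*(z*y)=0$; $x*0=x$; $x*y=0$ and $y*x=0$ imply $x=y$; $0*x=0$. A state BCK-algebra is a pair $(X,\mu)$ where $X$ is a BCK-algebra and $\mu:X\to X$ is a (left) state operator, i.e. for all $x,y\in X$: (S0) $x*y=0$ implies $\mu(x)*\mu(y)=0$; (S1) $\mu(x*y)=\mu(x)*\mu(x*(x*y))$; (S2) $\mu(\mu(x)*\mu(y))=\mu(x)*\mu(y)$. It is regarded as an algebra $(X,*,\mu,0)$ of type $(2,1,0)$. The sets $\mu(X)$ and $\operatorname{Ker}(\mu)$ are subalgebras of the BCK-algebra $X$. An ideal of $X$ is a subset $I$ with $0\in I$ such that $y*x\in I$ and $x\in I$ imply $y\in I$. For $a\in X$, $\langle a\rangle_X$ is the least ideal of $X$ containing $a$. An algebra $A$ of type $F$ is subdirectly irreducible if for every subdirect embedding $\alpha:A\to\prod_{i\in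 I}A_i$ (an injective homomorphism into a product of algebras of type $F$ such that $\pi_i(\alpha(A))=A_i$ for all $i$, with $\pi_i$ the projections) there is $i\in I$ such that $\pi_i\circ\alpha:A\to A_i$ is an isomorphism. For $(X,\mu)$ this is understood in type $(2,1,0)$, and for the subalgebras $\mu(X)$ and $\operatorname{Ker}(\mu)$ of $X$ it is understood as for BCK-algebras, in type $(2,0)$. *)

theory Defs
  imports Main "HOL-Library.FuncSet"
begin

(* A type of algebras is given by an arity function on operation symbols. *)

record ('f, 'a) ualg =
  carrier :: "'a set"
  interp :: "'f \<Rightarrow> 'a list \<Rightarrow> 'a"

definition algebra_of_type :: "('f \<Rightarrow> nat) \<Rightarrow> ('f, 'a) ualg \<Rightarrow> bool" where
  "algebra_of_type ar A \<longleftrightarrow> carrier A \<noteq> {} \<and>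
     (\<forall>f xs. set xs \<subseteq> carrier A \<and> length xs = ar f \<longrightarrow> interp A f xs \<in> carrier A)"

definition ualg_hom ::
  "('f \<Rightarrow> nat) \<Rightarrow> ('f, 'a) ualg \<Rightarrow> ('f, 'b) ualg \<Rightarrow> ('a \<Rightarrow> 'b) \<Rightarrow> bool" where
  "ualg_hom ar A B h \<longleftrightarrow> h \<in> carrier A \<rightarrow> carrier B \<and>
     (\<forall>f xs. set xs \<subseteq> carrier A \<and> length xs = ar f \<longrightarrow>
        h (interp A f xs) = interp B f (map h xs))"

definition ualg_iso ::
  "('f \<Rightarrow> nat) \<Rightarrow> ('f, 'a) ualg \<Rightarrow> ('f, 'b) ualg \<Rightarrow> ('a \<Rightarrow> 'b) \<Rightarrow> bool" where
  "ualg_iso ar A B h \<longleftrightarrow> ualg_hom ar A B h \<and> bij_betw h (carrier A) (carrier B)"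

definition ualg_product ::
  "'i set \<Rightarrow> ('i \<Rightarrow> ('f, 'b) ualg) \<Rightarrow> ('f, 'i \<Rightarrow> 'b) ualg" where
  "ualg_product I B =
     \<lparr>carrier = (\<Pi>\<^sub>E i\<in>I. carrier (B i)),
      interp = (\<lambda>f xs. \<lambda>i\<in>I. interp (B i) f (map (\<lambda>x. x i) xs))\<rparr>"

definition subdirect_embedding ::
  "('f \<Rightarrow> nat) \<Rightarrow> ('f, 'a) ualg \<Rightarrow> 'i set \<Rightarrow> ('i \<Rightarrow> ('f, 'b) ualg) \<Rightarrow> ('a \<Rightarrow> 'i \<Rightarrow> 'b) \<Rightarrow> bool"
  where
  "subdirect_embedding ar A I B \<alpha> \<longleftrightarrow>
     ualg_hom ar A (ualg_product I B) \<alpha> \<and> inj_on \<alpha> (carrier A) \<and>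
     (\<forall>i\<in>I. (\<lambda>x. \<alpha> x i) ` carrier A = carrier (B i))"

(* The types 'i and 'b bound the indices and the elements of the factors.  Every instance is
   implied by the one with 'i = 'a \<times> 'a and 'b = 'a, 'a being the element type of A: each factor
   is an image of A, so it has a copy on a set of representatives in A, and one factor for each
   pair of distinct elements of A, separating the pair, is enough for an embedding.
   The index set may be empty, so a one-element algebra is not subdirectly irreducible. *)
definition subdirectly_irreducible ::
  "'i itself \<Rightarrow> 'b itself \<Rightarrow> ('f \<Rightarrow> nat) \<Rightarrow> ('f, 'a) ualg \<Rightarrow> bool" where
  "subdirectly_irreducible (_ :: 'i itself) (_ :: 'b itself) ar A \<longleftrightarrow>
     (\<forall>(I :: 'i set) (B :: 'i \<Rightarrow> ('f, 'b) ualg) \<alpha>.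
        (\<forall>i\<in>I. algebra_of_type ar (B i)) \<and> subdirect_embedding ar A I B \<alpha> \<longrightarrow>
        (\<exists>i\<in>I. ualg_iso ar A (B i) (\<lambda>x. \<alpha> x i)))"

locale bck_algebra =
  fixes X :: "'a set"
    and star :: "'a \<Rightarrow> 'a \<Rightarrow> 'a" (infixl "\<star>" 70)
    and zero :: 'a ("\<zero>")
  assumes zero_closed: "\<zero> \<in> X"
    and star_closed: "x \<in> X \<Longrightarrow> y \<in> X \<Longrightarrow> x \<star> y \<in> X"
    and bck1: "x \<in> X \<Longrightarrow> y \<in> X \<Longrightarrow> z \<in> X \<Longrightarrow>
                 ((x \<star> y) \<star> (x \<star> z)) \<star> (z \<star> y) = \<zero>"
    and bck2: "x \<in> X \<Longrightarrow> x \<star> \<zero> = x"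
    and bck3: "x \<in> X \<Longrightarrow> y \<in> X \<Longrightarrow> x \<star> y = \<zero> \<Longrightarrow> y \<star> x = \<zero> \<Longrightarrow> x = y"
    and bck4: "x \<in> X \<Longrightarrow> \<zero> \<star> x = \<zero>"
begin

definition ideal :: "'a set \<Rightarrow> bool" where
  "ideal I \<longleftrightarrow> I \<subseteq> X \<and> \<zero> \<in> I \<and>
     (\<forall>x\<in>X. \<forall>y\<in>X. y \<star> x \<in> I \<and> x \<in> I \<longrightarrow> y \<in> I)"

definition generated_ideal :: "'a \<Rightarrow> 'a set" where
  "generated_ideal a = \<Inter>{I. ideal I \<and> a \<in> I}"

end

locale state_bck_algebra = bck_algebra X star zero
  for X :: "'a set"
    and star :: "'a \<Rightarrow> 'a \<Rightarrow> 'a" (infixl "\<star>" 70)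
    and zero :: 'a ("\<zero>") +
  fixes mu :: "'a \<Rightarrow> 'a" ("\<mu>")
  assumes mu_closed: "x \<in> X \<Longrightarrow> \<mu> x \<in> X"
    and S0: "x \<in> X \<Longrightarrow> y \<in> X \<Longrightarrow> x \<star> y = \<zero> \<Longrightarrow> \<mu> x \<star> \<mu> y = \<zero>"
    and S1: "x \<in> X \<Longrightarrow> y \<in> X \<Longrightarrow> \<mu> (x \<star> y) = \<mu> x \<star> \<mu> (x \<star> (x \<star> y))"
    and S2: "x \<in> X \<Longrightarrow> y \<in> X \<Longrightarrow> \<mu> (\<mu> x \<star> \<mu> y) = \<mu> x \<star> \<mu> y"

definition state_kernel :: "'a set \<Rightarrow> 'a \<Rightarrow> ('a \<Rightarrow> 'a) \<Rightarrow> 'a set" where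
  "state_kernel X zero mu = {x \<in> X. mu x = zero}"

datatype bck_sym = Star | Zero

primrec bck_arity :: "bck_sym \<Rightarrow> nat" where
  "bck_arity Star = 2"
| "bck_arity Zero = 0"

primrec bck_interp :: "('a \<Rightarrow> 'a \<Rightarrow> 'a) \<Rightarrow> 'a \<Rightarrow> bck_sym \<Rightarrow> 'a list \<Rightarrow> 'a" where
  "bck_interp star zero Star = (\<lambda>xs. star (xs ! 0) (xs ! 1))"
| "bck_interp star zero Zero = (\<lambda>xs. zero)"

definition bck_ualg :: "'a set \<Rightarrow> ('a \<Rightarrow> 'a \<Rightarrow> 'a) \<Rightarrow> 'a \<Rightarrow> (bck_sym, 'a) ualg" where
  "bck_ualg X star zero = \<lparr>carrier = X, interp = bck_interp star zero\<rparr>"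

datatype state_sym = SStar | SMu | SZero

primrec state_arity :: "state_sym \<Rightarrow> nat" where
  "state_arity SStar = 2"
| "state_arity SMu = 1"
| "state_arity SZero = 0"

primrec state_interp ::
  "('a \<Rightarrow> 'a \<Rightarrow> 'a) \<Rightarrow> ('a \<Rightarrow> 'a) \<Rightarrow> 'a \<Rightarrow> state_sym \<Rightarrow> 'a list \<Rightarrow> 'a" where
  "state_interp star mu zero SStar = (\<lambda>xs. star (xs ! 0) (xs ! 1))"
| "state_interp star mu zero SMu = (\<lambda>xs. mu (xs ! 0))"
| "state_interp star mu zero SZero = (\<lambda>xs. zero)"

definition state_ualg ::
  "'a set \<Rightarrow> ('a \<Rightarrow> 'a \<Rightarrow> 'a) \<Rightarrow> ('a \<Rightarrow> 'a) \<Rightarrow> 'a \<Rightarrow> (state_sym, 'a) ualg" where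
  "state_ualg X star mu zero = \<lparr>carrier = X, interp = state_interp star mu zero\<rparr>"

end

theory Submission imports Defs begin

text \<open>An algebra is subdirectly irreducible exactly when two distinct elements \<open>p\<close>, \<open>q\<close> are
identified by each of its non-trivial congruences (lemmas \<open>subdirectly_irreducible_imp_monolith_pair\<close>
and \<open>monolith_pair_imp_subdirectly_irreducible\<close>): this pair generates the monolith, the least
non-trivial congruence.  So a monolith pair of the subalgebra \<open>\<mu>(X)\<close> or \<open>Ker(\<mu>)\<close> is at hand, and it
is enough to show that it is also one for \<open>(X, \<mu>)\<close>.  Every congruence \<open>\<theta>\<close> of \<open>(X, \<mu>)\<close> restricts to
a congruence of the subalgebra, which identifies the pair as soon as it is non-trivial.  This
is how irreducibility passes up from the subalgebra (\<open>subdirectly_irreducible_lift\<close>).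

That the restriction is non-trivial comes from antisymmetry: if \<open>\<theta>\<close> identifies \<open>x \<noteq> y\<close>,
it identifies \<open>x \<star> y\<close> and \<open>y \<star> x\<close> with zero, and one of these is not zero.  So the zero class of \<open>\<theta>\<close>
is an ideal with an element \<open>a \<noteq> \<zero>\<close>, and it contains \<open>\<mu> a\<close> as well.  If the kernel of \<open>\<mu>\<close> is
trivial, \<open>\<mu> a\<close> is a non-zero element of \<open>\<mu>(X)\<close> identified with zero.  Otherwise a non-zero
element of \<open>Ker(\<mu>)\<close> is needed: \<open>a\<close> is one if \<open>\<mu> a = \<zero>\<close>, and else the intersection
hypothesis yields one in the ideal generated by \<open>\<mu> a\<close>, which lies in the zero class.

A quotient of a BCK-algebra need not be a BCK-algebra, since antisymmetry can fail.  It is still an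
algebra of the same type, and as such it may occur as a factor of a subdirect embedding;
therefore all equivalences compatible with the operations count as congruences here.\<close>

section \<open>Congruences and subdirect irreducibility\<close>

definition congruence :: "('f \<Rightarrow> nat) \<Rightarrow> ('f, 'a) ualg \<Rightarrow> ('a \<times> 'a) set \<Rightarrow> bool" where
  "congruence ar A \<theta> \<longleftrightarrow> equiv (carrier A) \<theta> \<and>
     (\<forall>f xs ys. length xs = ar f \<and> list_all2 (\<lambda>x y. (x, y) \<in> \<theta>) xs ys \<longrightarrow>
        (interp A f xs, interp A f ys) \<in> \<theta>)"

definition monolith_pair :: "('f \<Rightarrow> nat) \<Rightarrow> ('f, 'a) ualg \<Rightarrow> 'a \<Rightarrow> 'a \<Rightarrow> bool" where
  "monolith_pair ar A p q \<longleftrightarrow> p \<in> carrier A \<and> q \<in> carrier A \<and> p \<noteq> q \<and>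
     (\<forall>\<theta>. congruence ar A \<theta> \<and> \<not> \<theta> \<subseteq> Id \<longrightarrow> (p, q) \<in> \<theta>)"

lemma congruence_kernel:
  assumes A: "algebra_of_type ar A" and h: "ualg_hom ar A B h"
  shows "congruence ar A {(x, y). x \<in> carrier A \<and> y \<in> carrier A \<and> h x = h y}"
    (is "congruence ar A ?\<theta>")
proof -
  have "equiv (carrier A) ?\<theta>"
    by (auto intro!: equivI refl_onI symI transI)
  moreover have "(interp A f xs, interp A f ys) \<in> ?\<theta>"
    if len: "length xs = ar f" and rel: "list_all2 (\<lambda>x y. (x, y) \<in> ?\<theta>) xs ys" for f xs ys
  proof -
    have sub: "set xs \<subseteq> carrier A" "set ys \<subseteq> carrier A" and len': "length ys = ar f"
      and eq: "map h xs = map h ys"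
      using rel len by (auto simp: list_all2_conv_all_nth in_set_conv_nth intro: nth_equalityI)
    have "h (interp A f xs) = h (interp A f ys)"
      using h sub len len' eq by (simp add: ualg_hom_def)
    with A sub len len' show ?thesis by (auto simp: algebra_of_type_def)
  qed
  ultimately show ?thesis unfolding congruence_def by blast
qed

text \<open>Quotients by congruences are taken inside the algebra itself: the operations act on a set
of class representatives, which \<open>r\<close> chooses.  With the set of classes as its carrier, the quotient
would have element type \<open>'a set\<close> and could not serve as a factor with elements in \<open>'a\<close>.\<close>

lemma congruence_quotient:
  fixes A :: "('f, 'a) ualg"
  assumes A: "algebra_of_type ar A" and \<theta>: "congruence ar A \<theta>"
  obtains B :: "('f, 'a) ualg" and r :: "'a \<Rightarrow> 'a"
  where "algebra_of_type ar B" and "ualg_hom ar A B r" and "r ` carrier A = carrier B"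
    and "\<And>x y. x \<in> carrier A \<Longrightarrow> y \<in> carrier A \<Longrightarrow> r x = r y \<longleftrightarrow> (x, y) \<in> \<theta>"
proof -
  define r where "r x = (SOME y. (x, y) \<in> \<theta>)" for x
  define B where "B = \<lparr>carrier = r ` carrier A, interp = (\<lambda>f xs. r (interp A f xs))\<rparr>"
  have eqv: "equiv (carrier A) \<theta>" using \<theta> by (simp add: congruence_def)
  have rel: "(x, r x) \<in> \<theta>" if "x \<in> carrier A" for x
    unfolding r_def using that equiv_class_self[OF eqv that] by (auto intro: someI)
  have r_eq: "r x = r y \<longleftrightarrow> (x, y) \<in> \<theta>" if x: "x \<in> carrier A" and y: "y \<in> carrier A" for x y
  proof
    assume "r x = r y"
    then show "(x, y) \<in> \<theta>"
      using rel[OF x] rel[OF y] eqv unfolding equiv_def by (metis symD transD)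
  next
    assume "(x, y) \<in> \<theta>"
    then have "\<theta> `` {x} = \<theta> `` {y}" by (rule equiv_class_eq[OF eqv])
    then have "(x, z) \<in> \<theta> \<longleftrightarrow> (y, z) \<in> \<theta>" for z by auto
    then show "r x = r y" by (simp add: r_def)
  qed
  have r_closed: "r x \<in> carrier A" if "x \<in> carrier A" for x
    using rel[OF that] eqv by (meson equiv_class_eq_iff)
  have "algebra_of_type ar B"
    unfolding algebra_of_type_def
  proof (intro conjI allI impI)
    show "carrier B \<noteq> {}" using A by (simp add: B_def algebra_of_type_def)
  next
    fix f xs
    assume *: "set xs \<subseteq> carrier B \<and> length xs = ar f"
    then have "set xs \<subseteq> carrier A" using r_closed by (auto simp: B_def)
    then show "interp B f xs \<in> carrier B"
      using A * by (auto simp: B_def algebra_of_type_def)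
  qed
  moreover have "ualg_hom ar A B r"
    unfolding ualg_hom_def
  proof (intro conjI allI impI)
    show "r \<in> carrier A \<rightarrow> carrier B" by (simp add: B_def)
  next
    fix f xs
    assume *: "set xs \<subseteq> carrier A \<and> length xs = ar f"
    then have "list_all2 (\<lambda>x y. (x, y) \<in> \<theta>) xs (map r xs)"
      using rel by (auto simp: list_all2_conv_all_nth subset_eq)
    with * \<theta> have "(interp A f xs, interp A f (map r xs)) \<in> \<theta>"
      by (simp add: congruence_def)
    then have "r (interp A f xs) = r (interp A f (map r xs))"
      using r_eq eqv by (meson equiv_class_eq_iff)
    then show "r (interp A f xs) = interp B f (map r xs)" by (simp add: B_def)
  qed
  moreover have "r ` carrier A = carrier B" by (simp add: B_def)
  ultimately show thesis using r_eq by (rule that)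
qed

text \<open>If no pair is a monolith pair, each pair of distinct elements is separated by some
non-trivial congruence, and the quotients by these congruences form a subdirect embedding none of
whose components is injective.\<close>

lemma subdirectly_irreducible_imp_monolith_pair:
  fixes A :: "('f, 'a) ualg"
  assumes A: "algebra_of_type ar A"
    and si: "subdirectly_irreducible TYPE('a \<times> 'a) TYPE('a) ar A"
  obtains p q where "monolith_pair ar A p q"
proof (rule ccontr)
  assume "\<not> thesis"
  then have none: "\<not> monolith_pair ar A p q" for p q using that by blast
  define I where "I = {(p, q). p \<in> carrier A \<and> q \<in> carrier A \<and> p \<noteq> q}"
  have "\<exists>(B :: ('f, 'a) ualg) r. algebra_of_type ar B \<and> ualg_hom ar A B r \<and> r ` carrier A = carrier B \<and>
          r (fst i) \<noteq> r (snd i) \<and> \<not> inj_on r (carrier A)"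
    if mem: "i \<in> I" for i
  proof -
    obtain p q where i: "i = (p, q)" and pq: "p \<in> carrier A" "q \<in> carrier A" "p \<noteq> q"
      using mem by (auto simp: I_def)
    then obtain \<theta> where \<theta>: "congruence ar A \<theta>" "\<not> \<theta> \<subseteq> Id" "(p, q) \<notin> \<theta>"
      using none[of p q] by (auto simp: monolith_pair_def)
    obtain B :: "('f, 'a) ualg" and r where Br: "algebra_of_type ar B" "ualg_hom ar A B r"
        "r ` carrier A = carrier B"
      and r_eq: "\<And>x y. x \<in> carrier A \<Longrightarrow> y \<in> carrier A \<Longrightarrow> r x = r y \<longleftrightarrow> (x, y) \<in> \<theta>"
      using congruence_quotient[OF A \<theta>(1)] by metis
    obtain x y where xy: "(x, y) \<in> \<theta>" "x \<noteq> y" using \<theta>(2) by auto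
    have "x \<in> carrier A" "y \<in> carrier A"
      using xy(1) \<theta>(1) unfolding congruence_def by (meson equiv_class_eq_iff)+
    then have "\<not> inj_on r (carrier A)"
      using xy r_eq by (auto simp: inj_on_def)
    moreover have "r (fst i) \<noteq> r (snd i)" using r_eq[OF pq(1,2)] \<theta>(3) i by simp
    ultimately show ?thesis using Br by blast
  qed
  then obtain B :: "'a \<times> 'a \<Rightarrow> ('f, 'a) ualg" and r where
    Br: "\<And>i. i \<in> I \<Longrightarrow> algebra_of_type ar (B i) \<and> ualg_hom ar A (B i) (r i) \<and>
      r i ` carrier A = carrier (B i) \<and> r i (fst i) \<noteq> r i (snd i) \<and> \<not> inj_on (r i) (carrier A)"
    by metis
  define \<alpha> where "\<alpha> x = (\<lambda>i\<in>I. r i x)" for x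
  have "ualg_hom ar A (ualg_product I B) \<alpha>"
    unfolding ualg_hom_def
  proof (intro conjI allI impI)
    have "r i x \<in> carrier (B i)" if "i \<in> I" "x \<in> carrier A" for i x
      using Br[OF that(1)] that(2) by blast
    then show "\<alpha> \<in> carrier A \<rightarrow> carrier (ualg_product I B)"
      by (simp add: ualg_product_def \<alpha>_def)
  next
    fix f xs
    assume *: "set xs \<subseteq> carrier A \<and> length xs = ar f"
    have "r i (interp A f xs) = interp (B i) f (map (\<lambda>x. x i) (map \<alpha> xs))" if i: "i \<in> I" for i
    proof -
      have "map (\<lambda>x. x i) (map \<alpha> xs) = map (r i) xs" using i by (simp add: \<alpha>_def)
      moreover have "r i (interp A f xs) = interp (B i) f (map (r i) xs)"
        using Br[OF i] * by (simp add: ualg_hom_def)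
      ultimately show ?thesis by (simp only:)
    qed
    then show "\<alpha> (interp A f xs) = interp (ualg_product I B) f (map \<alpha> xs)"
      unfolding ualg_product_def \<alpha>_def[of "interp A f xs"] by (auto intro: restrict_ext)
  qed
  moreover have "inj_on \<alpha> (carrier A)"
  proof (rule inj_onI, rule ccontr)
    fix x y
    assume *: "x \<in> carrier A" "y \<in> carrier A" "\<alpha> x = \<alpha> y" "x \<noteq> y"
    then have i: "(x, y) \<in> I" by (simp add: I_def)
    from \<open>\<alpha> x = \<alpha> y\<close> have "\<alpha> x (x, y) = \<alpha> y (x, y)" by simp
    then show False using Br[OF i] i by (simp add: \<alpha>_def)
  qed
  moreover have "(\<lambda>x. \<alpha> x i) ` carrier A = carrier (B i)" if "i \<in> I" for i
    using Br[OF that] that by (simp add: \<alpha>_def)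
  ultimately have "subdirect_embedding ar A I B \<alpha>"
    by (simp add: subdirect_embedding_def)
  then obtain i where i: "i \<in> I" and iso: "ualg_iso ar A (B i) (\<lambda>x. \<alpha> x i)"
    using si Br unfolding subdirectly_irreducible_def by blast
  from iso have "inj_on (\<lambda>x. \<alpha> x i) (carrier A)" by (simp add: ualg_iso_def bij_betw_def)
  then show False using Br[OF i] i by (simp add: \<alpha>_def)
qed

text \<open>Some component of a subdirect embedding separates the monolith pair; its kernel does not
contain the pair, so it must be trivial.\<close>

lemma monolith_pair_imp_subdirectly_irreducible:
  fixes A :: "('f, 'a) ualg"
  assumes A: "algebra_of_type ar A" and pq: "monolith_pair ar A p q"
  shows "subdirectly_irreducible TYPE('i) TYPE('b) ar A"
  unfolding subdirectly_irreducible_def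
proof (intro allI impI)
  fix I :: "'i set" and B :: "'i \<Rightarrow> ('f, 'b) ualg" and \<alpha>
  assume "(\<forall>i\<in>I. algebra_of_type ar (B i)) \<and> subdirect_embedding ar A I B \<alpha>"
  then have hom: "ualg_hom ar A (ualg_product I B) \<alpha>" and inj: "inj_on \<alpha> (carrier A)"
    and onto: "\<And>i. i \<in> I \<Longrightarrow> (\<lambda>x. \<alpha> x i) ` carrier A = carrier (B i)"
    by (auto simp: subdirect_embedding_def)
  have p: "p \<in> carrier A" and q: "q \<in> carrier A" and "p \<noteq> q"
    using pq by (auto simp: monolith_pair_def)
  then have "\<alpha> p \<noteq> \<alpha> q" using inj by (auto dest: inj_onD)
  moreover have "\<alpha> p \<in> (\<Pi>\<^sub>E i\<in>I. carrier (B i))" "\<alpha> q \<in> (\<Pi>\<^sub>E i\<in>I. carrier (B i))"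
    using hom p q by (auto simp: ualg_hom_def ualg_product_def)
  ultimately obtain i where i: "i \<in> I" and sep: "\<alpha> p i \<noteq> \<alpha> q i"
    by (meson PiE_ext)
  have hom_i: "ualg_hom ar A (B i) (\<lambda>x. \<alpha> x i)"
    using hom i onto[OF i] by (auto simp: ualg_hom_def ualg_product_def comp_def)
  have "(p, q) \<notin> {(x, y). x \<in> carrier A \<and> y \<in> carrier A \<and> \<alpha> x i = \<alpha> y i}"
    using sep by simp
  then have "{(x, y). x \<in> carrier A \<and> y \<in> carrier A \<and> \<alpha> x i = \<alpha> y i} \<subseteq> Id"
    using pq congruence_kernel[OF A hom_i] unfolding monolith_pair_def by blast
  then have "inj_on (\<lambda>x. \<alpha> x i) (carrier A)" by (auto simp: inj_on_def)
  then have "ualg_iso ar A (B i) (\<lambda>x. \<alpha> x i)"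
    using hom_i onto[OF i] by (simp add: ualg_iso_def bij_betw_def)
  with i show "\<exists>i\<in>I. ualg_iso ar A (B i) (\<lambda>x. \<alpha> x i)" by blast
qed

section \<open>Congruences of a state BCK-algebra\<close>

context state_bck_algebra
begin

lemma star_self: "x \<in> X \<Longrightarrow> x \<star> x = \<zero>"
  using bck1[of x \<zero> \<zero>] by (simp add: zero_closed star_closed bck2)

lemma mu_zero: "\<mu> \<zero> = \<zero>"
  using S1[of \<zero> \<zero>] by (simp add: zero_closed mu_closed bck2 star_self)

lemma algebra_of_type_state_ualg: "algebra_of_type state_arity (state_ualg X star \<mu> \<zero>)"
proof -
  have "state_interp star \<mu> \<zero> f xs \<in> X" if "set xs \<subseteq> X" "length xs = state_arity f" for f xs
    using that
    by (cases f) (auto simp: zero_closed subset_eq intro!: star_closed mu_closed)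
  then show ?thesis using zero_closed by (auto simp: algebra_of_type_def state_ualg_def)
qed

context
  fixes \<theta>
  assumes cong: "congruence state_arity (state_ualg X star \<mu> \<zero>) \<theta>"
begin

lemma equiv_congruence: "equiv X \<theta>"
  using cong by (simp add: congruence_def state_ualg_def)

lemma congruence_in: "(x, y) \<in> \<theta> \<Longrightarrow> x \<in> X \<and> y \<in> X"
  using equiv_congruence by (meson equiv_class_eq_iff)

lemma congruence_refl: "x \<in> X \<Longrightarrow> (x, x) \<in> \<theta>"
  using equiv_congruence by (meson equiv_def refl_onD)

lemma congruence_sym: "(x, y) \<in> \<theta> \<Longrightarrow> (y, x) \<in> \<theta>"
  using equiv_congruence by (meson equiv_def symD)

lemma congruence_trans: "(x, y) \<in> \<theta> \<Longrightarrow> (y, z) \<in> \<theta> \<Longrightarrow> (x, z) \<in> \<theta>"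
  using equiv_congruence by (meson equiv_def transD)

lemma congruence_star: "(x, x') \<in> \<theta> \<Longrightarrow> (y, y') \<in> \<theta> \<Longrightarrow> (x \<star> y, x' \<star> y') \<in> \<theta>"
  using cong[unfolded congruence_def, THEN conjunct2, rule_format, of "[x, y]" SStar "[x', y']"]
  by (simp add: state_ualg_def)

lemma congruence_mu: "(x, x') \<in> \<theta> \<Longrightarrow> (\<mu> x, \<mu> x') \<in> \<theta>"
  using cong[unfolded congruence_def, THEN conjunct2, rule_format, of "[x]" SMu "[x']"]
  by (simp add: state_ualg_def)

text \<open>Identified elements have their differences in the zero class, and antisymmetry makes one of the
two differences non-zero when the elements are distinct.\<close>

lemma nontrivial_congruence_zero_class:
  assumes "\<not> \<theta> \<subseteq> Id"
  obtains a where "(a, \<zero>) \<in> \<theta>" and "a \<noteq> \<zero>"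
proof -
  obtain x y where xy: "(x, y) \<in> \<theta>" "x \<noteq> y" using assms by auto
  then have X: "x \<in> X" "y \<in> X" using congruence_in by auto
  have "(x \<star> y, \<zero>) \<in> \<theta>" "(y \<star> x, \<zero>) \<in> \<theta>"
    using congruence_star[OF xy(1) congruence_refl[OF X(2)]]
      congruence_star[OF congruence_refl[OF X(2)] xy(1)] X congruence_sym
    by (auto simp: star_self)
  moreover have "x \<star> y \<noteq> \<zero> \<or> y \<star> x \<noteq> \<zero>" using bck3 X xy(2) by auto
  ultimately show thesis using that by blast
qed

text \<open>If \<open>x\<close> is identified with zero, then \<open>y \<star> x\<close> is identified with \<open>y \<star> \<zero> = y\<close>.\<close>

lemma ideal_zero_class: "ideal {x. (x, \<zero>) \<in> \<theta>}"
  unfolding ideal_def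
proof (intro conjI ballI impI)
  show "{x. (x, \<zero>) \<in> \<theta>} \<subseteq> X" using congruence_in by auto
  show "\<zero> \<in> {x. (x, \<zero>) \<in> \<theta>}" using congruence_refl zero_closed by simp
  fix x y
  assume X: "x \<in> X" "y \<in> X" and *: "y \<star> x \<in> {x. (x, \<zero>) \<in> \<theta>} \<and> x \<in> {x. (x, \<zero>) \<in> \<theta>}"
  then have "(y \<star> x, y) \<in> \<theta>"
    using congruence_star[OF congruence_refl[OF X(2)], of x \<zero>] X bck2 by simp
  then show "y \<in> {x. (x, \<zero>) \<in> \<theta>}" using * congruence_sym congruence_trans by blast
qed

lemma generated_ideal_in_zero_class:
  assumes "(a, \<zero>) \<in> \<theta>" and "b \<in> generated_ideal a"
  shows "(b, \<zero>) \<in> \<theta>"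
  using assms ideal_zero_class by (auto simp: generated_ideal_def)

lemma congruence_restrict:
  assumes "K \<subseteq> X" and "\<zero> \<in> K" and "\<And>x y. x \<in> K \<Longrightarrow> y \<in> K \<Longrightarrow> x \<star> y \<in> K"
  shows "congruence bck_arity (bck_ualg K star \<zero>) (\<theta> \<inter> K \<times> K)"
proof -
  have "equiv K (\<theta> \<inter> K \<times> K)"
    using assms(1) congruence_refl congruence_sym congruence_trans
    by (intro equivI refl_onI symI transI) blast+
  moreover have "(bck_interp star \<zero> f xs, bck_interp star \<zero> f ys) \<in> \<theta> \<inter> K \<times> K"
    if "length xs = bck_arity f" "list_all2 (\<lambda>x y. (x, y) \<in> \<theta> \<inter> K \<times> K) xs ys" for f xs ys
  proof (cases f)
    case Star
    with that have "(xs ! 0, ys ! 0) \<in> \<theta> \<inter> K \<times> K" "(xs ! 1, ys ! 1) \<in> \<theta> \<inter> K \<times> K"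
      by (simp_all add: list_all2_conv_all_nth)
    then show ?thesis using Star assms(3) congruence_star by auto
  next
    case Zero
    then show ?thesis using assms(2) congruence_refl zero_closed by simp
  qed
  ultimately show ?thesis unfolding congruence_def bck_ualg_def ualg.simps by blast
qed

end

section \<open>Irreducibility inherited from a subalgebra\<close>

text \<open>A congruence that identifies a non-zero element of \<open>K\<close> with zero restricts to a non-trivial
congruence of \<open>K\<close>, so it contains a monolith pair of \<open>K\<close>.\<close>

lemma subdirectly_irreducible_lift:
  assumes K: "K \<subseteq> X" "\<zero> \<in> K" "\<And>x y. x \<in> K \<Longrightarrow> y \<in> K \<Longrightarrow> x \<star> y \<in> K"
    and si: "subdirectly_irreducible TYPE('a \<times> 'a) TYPE('a) bck_arity (bck_ualg K star \<zero>)"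
    and meets: "\<And>\<theta>. congruence state_arity (state_ualg X star \<mu> \<zero>) \<theta> \<Longrightarrow> \<not> \<theta> \<subseteq> Id \<Longrightarrow>
        \<exists>a\<in>K. a \<noteq> \<zero> \<and> (a, \<zero>) \<in> \<theta>"
  shows "subdirectly_irreducible TYPE('i) TYPE('b) state_arity (state_ualg X star \<mu> \<zero>)"
proof -
  have "bck_interp star \<zero> f xs \<in> K" if "set xs \<subseteq> K" "length xs = bck_arity f" for f xs
    using that by (cases f) (auto simp: K(2) subset_eq intro!: K(3))
  then have "algebra_of_type bck_arity (bck_ualg K star \<zero>)"
    using K(2) by (auto simp: algebra_of_type_def bck_ualg_def)
  then obtain p q where pq: "monolith_pair bck_arity (bck_ualg K star \<zero>) p q"
    using si by (rule subdirectly_irreducible_imp_monolith_pair)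
  have "(p, q) \<in> \<theta>"
    if \<theta>: "congruence state_arity (state_ualg X star \<mu> \<zero>) \<theta>" "\<not> \<theta> \<subseteq> Id" for \<theta>
  proof -
    have "congruence bck_arity (bck_ualg K star \<zero>) (\<theta> \<inter> K \<times> K)"
      by (rule congruence_restrict[OF \<theta>(1) K])
    moreover have "\<not> \<theta> \<inter> K \<times> K \<subseteq> Id" using meets[OF \<theta>] K(2) by auto
    ultimately show ?thesis using pq unfolding monolith_pair_def by blast
  qed
  then have "monolith_pair state_arity (state_ualg X star \<mu> \<zero>) p q"
    using pq K(1) by (auto simp: monolith_pair_def bck_ualg_def state_ualg_def)
  with algebra_of_type_state_ualg show ?thesis
    by (rule monolith_pair_imp_subdirectly_irreducible)
qed

end

theorem theorem3p15:
  fixes X :: "'a set" and star :: "'a \<Rightarrow> 'a \<Rightarrow> 'a" and zero :: 'a and mu :: "'a \<Rightarrow> 'a"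
  assumes "state_bck_algebra X star zero mu"
    and "(state_kernel X zero mu = {zero} \<and>
          subdirectly_irreducible TYPE('a \<times> 'a) TYPE('a) bck_arity (bck_ualg (mu ` X) star zero))
       \<or> (state_kernel X zero mu \<noteq> {zero} \<and>
          subdirectly_irreducible TYPE('a \<times> 'a) TYPE('a) bck_arity
            (bck_ualg (state_kernel X zero mu) star zero) \<and>
          (\<forall>a \<in> mu ` X. a \<noteq> zero \<longrightarrow>
             state_kernel X zero mu \<inter> bck_algebra.generated_ideal X star zero a \<noteq> {zero}))"
  shows "subdirectly_irreducible TYPE('i) TYPE('b) state_arity (state_ualg X star mu zero)"
proof -
  interpret state_bck_algebra X star zero mu by (rule assms(1))
  let ?K = "state_kernel X zero mu"
  have nonzero: "\<exists>a\<in>X. a \<noteq> zero \<and> (a, zero) \<in> \<theta> \<and> (mu a, zero) \<in> \<theta>"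
    if \<theta>: "congruence state_arity (state_ualg X star mu zero) \<theta>" "\<not> \<theta> \<subseteq> Id" for \<theta>
  proof -
    obtain a where a: "(a, zero) \<in> \<theta>" "a \<noteq> zero"
      by (rule nontrivial_congruence_zero_class[OF \<theta>])
    then show ?thesis
      using congruence_mu[OF \<theta>(1) a(1)] congruence_in[OF \<theta>(1) a(1)] mu_zero by auto
  qed
  from assms(2) show ?thesis
  proof (elim disjE conjE)
    assume trivial: "?K = {zero}"
      and si: "subdirectly_irreducible TYPE('a \<times> 'a) TYPE('a) bck_arity (bck_ualg (mu ` X) star zero)"
    show ?thesis
    proof (rule subdirectly_irreducible_lift[OF _ _ _ si])
      show "mu ` X \<subseteq> X" using mu_closed by auto
      show "zero \<in> mu ` X" using mu_zero zero_closed by (metis imageI)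
      show "star x y \<in> mu ` X" if xy: "x \<in> mu ` X" "y \<in> mu ` X" for x y
      proof -
        obtain u v where uv: "u \<in> X" "v \<in> X" "x = mu u" "y = mu v"
          using xy by blast
        then have "star x y = mu (star x y)" using S2 by simp
        moreover have "star x y \<in> X" using uv by (simp add: mu_closed star_closed)
        ultimately show ?thesis by (rule image_eqI)
      qed
    next
      fix \<theta>
      assume "congruence state_arity (state_ualg X star mu zero) \<theta>" "\<not> \<theta> \<subseteq> Id"
      then obtain a where "a \<in> X" "a \<noteq> zero" "(mu a, zero) \<in> \<theta>" using nonzero by blast
      moreover from this have "mu a \<noteq> zero" using trivial by (auto simp: state_kernel_def)
      ultimately show "\<exists>b\<in>mu ` X. b \<noteq> zero \<and> (b, zero) \<in> \<theta>" by blast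
    qed
  next
    assume si: "subdirectly_irreducible TYPE('a \<times> 'a) TYPE('a) bck_arity (bck_ualg ?K star zero)"
      and dense: "\<forall>a\<in>mu ` X. a \<noteq> zero \<longrightarrow> ?K \<inter> generated_ideal a \<noteq> {zero}"
    have zero_K: "zero \<in> ?K" by (simp add: state_kernel_def mu_zero zero_closed)
    show ?thesis
    proof (rule subdirectly_irreducible_lift[OF _ zero_K _ si])
      show "?K \<subseteq> X" by (auto simp: state_kernel_def)
      show "star x y \<in> ?K" if "x \<in> ?K" "y \<in> ?K" for x y
        using that S1[of x y] by (auto simp: state_kernel_def star_closed mu_closed bck4)
    next
      fix \<theta>
      assume \<theta>: "congruence state_arity (state_ualg X star mu zero) \<theta>" "\<not> \<theta> \<subseteq> Id"
      then obtain a where a: "a \<in> X" "a \<noteq> zero" "(a, zero) \<in> \<theta>" "(mu a, zero) \<in> \<theta>"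
        using nonzero by blast
      show "\<exists>b\<in>?K. b \<noteq> zero \<and> (b, zero) \<in> \<theta>"
      proof (cases "mu a = zero")
        case True
        with a show ?thesis by (auto simp: state_kernel_def)
      next
        case False
        then have "?K \<inter> generated_ideal (mu a) \<noteq> {zero}" using dense a(1) by blast
        moreover have "zero \<in> ?K \<inter> generated_ideal (mu a)"
          using zero_K by (simp add: generated_ideal_def ideal_def)
        ultimately obtain b where "b \<in> ?K" "b \<noteq> zero" "b \<in> generated_ideal (mu a)" by blast
        then show ?thesis using generated_ideal_in_zero_class[OF \<theta>(1) a(4)] by blast
      qed
    qed
  qed
qed

end
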